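(* Let $g(x)$ be a symmetric polynomial of degree $n\ge 1$ with complex coefficients, and for each integer $k$ let $s_k$ be the sum of the $k$-th powers of the roots of $g$, each root being repeated according to its multiplicity. If the Hermitian form $$\mathfrak{S}=\sum_{i,k=0}^{n-1}s_{i-k}\,x_i\overline{x}_k$$ in the complex variables $x_0,\dots,x_{n-1}$ has $\pi$ positive squared terms and $\nu$ negative squared terms, then $g(x)$ has exactly $\pi-\nu$ distinct roots of absolute value $1$ and exactly $\nu$ distinct pairs of roots $\beta,\beta^{*}$ (with $\beta^{*}=1/\overline{\beta}$, $|\beta|\ne 1$) symmetric with respect to the circle $|x|=1$.
   Context: A polynomial $g(x)=a_0+a_1x+\dots+a_nx^n$ of degree $n$ with complex coefficients is called symmetric if $g(x)=g^{*}(x)$, where $g^{*}(x)=x^n\overline{g}(1/x)$ and $\overline{g}$ denotes the polynomial whose coefficients are the complex conjugates of those of $g$; equivalently $a_k=\overline{a}_{n-k}$ for all $k$ (in particular $a_0=\overline{a}_n\neq 0$, so $0$ is not a root and $s_k$ makes sense for negative $k$). For such $g$ one has $s_{-k}=\overline{s}_k$, so $\mathfrak{S}$ is Hermitian. Together with any root $\beta$ with $|\beta|\neq 1$, $g$ also has the root $\beta^*=1/\overline\beta$ with the same multiplicity. The numbers $\pi$ and $\nu$ of positive and negative squared terms of a Hermitian form are the numbers of positive and negative coefficients in any representation of it as a real linear combination of squared absolute values of linearly independent linear forms (i.e. the numbers of positive and negative eigenvalues of its matrix). *)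

theory Defs
  imports "HOL-Analysis.Analysis" "HOL-Computational_Algebra.Computational_Algebra"
begin

(* reflect_poly p is x ^ degree p * p (1/x), so for a polynomial g of degree n the right-hand
   side is g* (x) = x ^ n * (conjugate of g) (1/x), using that g and its conjugate have the same
   degree. *)
definition symmetric_poly :: "complex poly \<Rightarrow> bool" where
  "symmetric_poly g \<longleftrightarrow> g = reflect_poly (map_poly cnj g)"

definition root_power_sum :: "complex poly \<Rightarrow> int \<Rightarrow> complex" where
  "root_power_sum g k = (\<Sum>z\<in>#proots g. z powi k)"

(* The form in the variables x 0, ..., x (n - 1); values of x at indices >= n are irrelevant. *)
definition root_form :: "complex poly \<Rightarrow> (nat \<Rightarrow> complex) \<Rightarrow> complex" where
  "root_form g x =
     (\<Sum>i<degree g. \<Sum>k<degree g. root_power_sum g (int i - int k) * x i * cnj (x k))"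

definition linear_form :: "nat \<Rightarrow> (nat \<Rightarrow> complex) \<Rightarrow> (nat \<Rightarrow> complex) \<Rightarrow> complex" where
  "linear_form n a x = (\<Sum>i<n. a i * x i)"

definition indep_linear_forms :: "nat \<Rightarrow> nat \<Rightarrow> (nat \<Rightarrow> nat \<Rightarrow> complex) \<Rightarrow> bool" where
  "indep_linear_forms n m L \<longleftrightarrow>
     (\<forall>u. (\<forall>x. (\<Sum>j<m. u j * linear_form n (L j) x) = 0) \<longrightarrow> (\<forall>j<m. u j = 0))"

(* The form H in n complex variables has p positive and q negative squared terms: it is a real
   linear combination of squared absolute values of m linearly independent linear forms with p
   positive and q negative coefficients (zero coefficients are allowed).  Every Hermitian form has
   such a representation, and by the law of inertia p and q do not depend on its choice. *)
definition squared_terms ::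
    "nat \<Rightarrow> ((nat \<Rightarrow> complex) \<Rightarrow> complex) \<Rightarrow> nat \<Rightarrow> nat \<Rightarrow> bool" where
  "squared_terms n H p q \<longleftrightarrow>
     (\<exists>m (c :: nat \<Rightarrow> real) L.
        indep_linear_forms n m L \<and>
        (\<forall>x. H x = of_real (\<Sum>j<m. c j * (cmod (linear_form n (L j) x))\<^sup>2)) \<and>
        p = card {j. j < m \<and> c j > 0} \<and>
        q = card {j. j < m \<and> c j < 0})"

end

(* Write X(z) = x_0 + x_1 z + ... + x_(n-1) z^(n-1) and z' = 1 / cnj z.  Since
   z^(i-k) = z^i * cnj (z'^k), the form equals the sum of m_z X(z) cnj (X(z')) over the distinct
   roots z of g, where m_z = m_z' is the multiplicity of z.  A root on the unit circle contributes
   m_z |X(z)|^2, and a pair z, z' contributes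
   2 m_z Re (X(z) cnj (X(z'))) = m_z/2 (|X(z) + X(z')|^2 - |X(z) - X(z')|^2).
   By Lagrange interpolation these linear forms are independent, so that Sylvester's law of
   inertia yields the numbers of positive and negative squared terms. *)

theory Submission
  imports Defs
begin

section \<open>The law of inertia for sums of squares of linear forms\<close>

text \<open>Gaussian elimination, by induction on the equations: an equation with a nonzero
  coefficient eliminates one unknown, which leaves one equation and one unknown fewer. The index
  \<open>i\<close> counts equations and \<open>j\<close> unknowns.\<close>

lemma homogeneous_system_nontrivial_solution:
  fixes A :: "'i \<Rightarrow> 'j \<Rightarrow> 'a::field"
  assumes "finite I" "finite J" "card I < card J"
  shows "\<exists>u. (\<exists>j\<in>J. u j \<noteq> 0) \<and> (\<forall>i\<in>I. (\<Sum>j\<in>J. u j * A i j) = 0)"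
  using assms
proof (induction I arbitrary: J A rule: finite_induct)
  case empty
  then obtain j where "j \<in> J" by fastforce
  then show ?case by (intro exI[of _ "\<lambda>_. 1"]) auto
next
  case (insert i I)
  show ?case
  proof (cases "\<forall>j\<in>J. A i j = 0")
    case True
    from insert have "card I < card J" by simp
    from insert.IH[OF \<open>finite J\<close> this, of A] True show ?thesis by auto
  next
    case False
    then obtain j0 where j0: "j0 \<in> J" "A i j0 \<noteq> 0" by auto
    define K where "K = J - {j0}"
    have J: "J = insert j0 K" "j0 \<notin> K" "finite K"
      using j0 insert.prems by (auto simp: K_def)
    have "card I < card K" using insert J by simp
    \<comment> \<open>These are the coefficients left after solving equation \<open>i\<close> for
      the unknown \<open>j0\<close> and substituting; \<open>w\<close> below restores the eliminated
      value.\<close>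
    from insert.IH[OF \<open>finite K\<close> this, of "\<lambda>k j. A k j - A k j0 * A i j / A i j0"]
    obtain u where u: "\<exists>j\<in>K. u j \<noteq> 0"
      "\<And>k. k \<in> I \<Longrightarrow> (\<Sum>j\<in>K. u j * (A k j - A k j0 * A i j / A i j0)) = 0"
      by blast
    define w where "w = u(j0 := - (\<Sum>j\<in>K. u j * A i j) / A i j0)"
    have sum_w: "(\<Sum>j\<in>J. w j * A k j) = w j0 * A k j0 + (\<Sum>j\<in>K. u j * A k j)" for k
    proof -
      have "(\<Sum>j\<in>K. w j * A k j) = (\<Sum>j\<in>K. u j * A k j)"
        using J by (intro sum.cong) (auto simp: w_def)
      then show ?thesis using J by simp
    qed
    have "(\<Sum>j\<in>J. w j * A k j) = 0" if "k \<in> insert i I" for k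
    proof (cases "k = i")
      case True
      then show ?thesis using j0 by (simp add: sum_w) (simp add: w_def)
    next
      case False
      then have "0 = (\<Sum>j\<in>K. u j * A k j - (u j * A i j) * (A k j0 / A i j0))"
        using u(2)[of k] that by (simp add: algebra_simps)
      also have "\<dots> = (\<Sum>j\<in>K. u j * A k j) - (\<Sum>j\<in>K. u j * A i j) * (A k j0 / A i j0)"
        by (simp add: sum_subtractf sum_distrib_right sum_divide_distrib)
      also have "\<dots> = (\<Sum>j\<in>J. w j * A k j)"
        unfolding sum_w by (simp add: w_def)
      finally show ?thesis by simp
    qed
    moreover have "\<exists>j\<in>J. w j \<noteq> 0"
      using u(1) J by (auto simp: w_def)
    ultimately show ?thesis by blast
  qed
qed

section \<open>Linear forms and dual vectors\<close>

lemma linear_form_sum_right: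
  "linear_form n a (\<lambda>t. \<Sum>j\<in>J. u j * v j t) = (\<Sum>j\<in>J. u j * linear_form n a (v j))"
  unfolding linear_form_def sum_distrib_left
  by (subst sum.swap) (simp add: algebra_simps)

lemma linear_form_add_scaled_right:
  "linear_form n a (\<lambda>t. x t + r * y t) = linear_form n a x + r * linear_form n a y"
  by (simp add: linear_form_def sum.distrib sum_distrib_left algebra_simps)

lemma linear_form_scaled_right: "linear_form n a (\<lambda>t. r * y t) = r * linear_form n a y"
  by (simp add: linear_form_def sum_distrib_left algebra_simps)

lemma linear_form_add_scaled_left:
  "linear_form n (\<lambda>t. a t + r * b t) x = linear_form n a x + r * linear_form n b x"
  by (simp add: linear_form_def sum.distrib sum_distrib_left algebra_simps)

lemma indep_linear_forms_Suc_imp: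
  assumes "indep_linear_forms n (Suc m) L"
  shows "indep_linear_forms n m L"
  unfolding indep_linear_forms_def
proof (intro allI impI)
  fix u j assume u: "\<forall>x. (\<Sum>j<m. u j * linear_form n (L j) x) = 0" and "j < m"
  have "\<forall>x. (\<Sum>j<Suc m. (u(m := 0)) j * linear_form n (L j) x) = 0"
    using u by simp
  with assms have "\<forall>j<Suc m. (u(m := 0)) j = 0"
    unfolding indep_linear_forms_def by blast
  with \<open>j < m\<close> show "u j = 0" by (auto dest: spec[of _ j])
qed

text \<open>Converts independence, which speaks of coefficients, into vectors on which the forms
  take prescribed values, as the inertia argument requires. The system is built one form at a time,
  in the manner of Gram-Schmidt.\<close>

lemma indep_linear_forms_dual_vectors:
  assumes "indep_linear_forms n m L"
  shows "\<exists>v. \<forall>j<m. \<forall>k<m. linear_form n (L j) (v k) = of_bool (j = k)"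
  using assms
proof (induction m)
  case 0
  then show ?case by simp
next
  case (Suc m)
  from Suc.IH[OF indep_linear_forms_Suc_imp[OF Suc.prems]]
  obtain v where v: "\<And>j k. j < m \<Longrightarrow> k < m \<Longrightarrow> linear_form n (L j) (v k) = of_bool (j = k)"
    by blast
  \<comment> \<open>The combination of forms with coefficients \<open>u\<close> vanishes on every
    earlier \<open>v k\<close>. Its last coefficient is 1, so by independence it is nonzero at some
    \<open>w\<close>.\<close>
  define u where "u = (\<lambda>j. if j = m then 1 else - linear_form n (L m) (v j))"
  have "u m \<noteq> 0" by (simp add: u_def)
  with Suc.prems obtain w where "(\<Sum>j<Suc m. u j * linear_form n (L j) w) \<noteq> 0"
    unfolding indep_linear_forms_def by (metis lessI)
  then have w: "linear_form n (L m) w - (\<Sum>j<m. linear_form n (L m) (v j) * linear_form n (L j) w) \<noteq> 0"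
    by (simp add: u_def sum_negf)
  \<comment> \<open>Removing from \<open>w\<close> its components along the earlier dual vectors
    makes all earlier forms vanish at \<open>y\<close>, while the form \<open>L m\<close> keeps the
    nonzero value found above.\<close>
  define y where "y = (\<lambda>t. w t + (-1) * (\<Sum>j<m. linear_form n (L j) w * v j t))"
  have y: "linear_form n a y
      = linear_form n a w - (\<Sum>j<m. linear_form n (L j) w * linear_form n a (v j))" for a
    unfolding y_def linear_form_add_scaled_right linear_form_sum_right by simp
  have y_less: "linear_form n (L k) y = 0" if "k < m" for k
  proof -
    have "(\<Sum>j<m. linear_form n (L j) w * linear_form n (L k) (v j))
        = (\<Sum>j<m. if j = k then linear_form n (L j) w else 0)"
      using that by (intro sum.cong) (auto simp: v)
    then show ?thesis using that by (simp add: y)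
  qed
  have y_m: "linear_form n (L m) y \<noteq> 0"
    using w by (simp add: y mult.commute)
  \<comment> \<open>A multiple of \<open>y\<close> serves as the new vector. Subtracting multiples
    of \<open>y\<close> from the old ones makes \<open>L m\<close> vanish there and leaves the
    earlier forms unchanged.\<close>
  define v' where "v' = (\<lambda>k. if k = m then (\<lambda>t. (1 / linear_form n (L m) y) * y t)
    else (\<lambda>t. v k t + (- linear_form n (L m) (v k) / linear_form n (L m) y) * y t))"
  have v': "linear_form n a (v' k) = (if k = m then linear_form n a y / linear_form n (L m) y
      else linear_form n a (v k)
        - linear_form n (L m) (v k) / linear_form n (L m) y * linear_form n a y)" for a k
  proof (cases "k = m")
    case True
    then have "v' k = (\<lambda>t. (1 / linear_form n (L m) y) * y t)" by (simp add: v'_def)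
    with True show ?thesis by (simp only: linear_form_scaled_right) simp
  next
    case False
    then have "v' k = (\<lambda>t. v k t + (- linear_form n (L m) (v k) / linear_form n (L m) y) * y t)"
      by (simp add: v'_def)
    with False show ?thesis by (simp only: linear_form_add_scaled_right) simp
  qed
  have "linear_form n (L j) (v' k) = of_bool (j = k)" if "j < Suc m" "k < Suc m" for j k
    using that y_m v[of j k] y_less[of j] by (auto simp: v' less_Suc_eq)
  then show ?case by blast
qed

section \<open>Sylvester's law of inertia\<close>

text \<open>Dimension count: otherwise some nontrivial combination of the \<open>v j\<close> with
  \<open>c j > 0\<close> would be annihilated by every \<open>M i\<close> with
  \<open>d i > 0\<close>. At that vector the left side is positive and the right side is at most
  0.\<close>

lemma inertia_le:
  fixes c :: "'j \<Rightarrow> real" and d :: "'i \<Rightarrow> real"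
  assumes "finite J" "finite I"
    and dual: "\<And>j k. j \<in> J \<Longrightarrow> k \<in> J \<Longrightarrow> linear_form n (L j) (v k) = of_bool (j = k)"
    and eq: "\<And>x. (\<Sum>j\<in>J. c j * (cmod (linear_form n (L j) x))\<^sup>2)
                = (\<Sum>i\<in>I. d i * (cmod (linear_form n (M i) x))\<^sup>2)"
  shows "card {j \<in> J. c j > 0} \<le> card {i \<in> I. d i > 0}"
proof (rule ccontr)
  define P where "P = {j \<in> J. c j > 0}"
  define Q where "Q = {i \<in> I. d i > 0}"
  have fin: "finite P" "finite Q" using assms by (auto simp: P_def Q_def)
  assume "\<not> ?thesis"
  then have "card Q < card P" by (simp add: P_def Q_def)
  from homogeneous_system_nontrivial_solution[OF fin(2,1) this,
      of "\<lambda>i j. linear_form n (M i) (v j)"]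
  obtain u j0 where j0: "j0 \<in> P" "u j0 \<noteq> 0"
    and u: "\<And>i. i \<in> Q \<Longrightarrow> (\<Sum>j\<in>P. u j * linear_form n (M i) (v j)) = 0" by blast
  define x where "x = (\<lambda>t. \<Sum>j\<in>P. u j * v j t)"
  have lf: "linear_form n a x = (\<Sum>j\<in>P. u j * linear_form n a (v j))" for a
    unfolding x_def by (rule linear_form_sum_right)
  \<comment> \<open>By duality, \<open>x\<close> has coordinate \<open>u k\<close> at each positive
    term and 0 at all others, so negative terms contribute nothing on the left.\<close>
  have L: "linear_form n (L k) x = (if k \<in> P then u k else 0)" if "k \<in> J" for k
  proof -
    have "linear_form n (L k) x = (\<Sum>j\<in>P. if j = k then u j else 0)"
      unfolding lf using that by (intro sum.cong) (auto simp: dual P_def)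
    then show ?thesis using fin by (simp add: sum.delta)
  qed
  have "0 < (\<Sum>j\<in>J. c j * (cmod (linear_form n (L j) x))\<^sup>2)"
    using j0 \<open>finite J\<close> by (intro sum_pos2[of _ j0]) (auto simp: L P_def)
  also have "\<dots> = (\<Sum>i\<in>I. d i * (cmod (linear_form n (M i) x))\<^sup>2)" by (rule eq)
  also have "\<dots> \<le> 0"
  proof (intro sum_nonpos)
    fix i assume "i \<in> I"
    then show "d i * (cmod (linear_form n (M i) x))\<^sup>2 \<le> 0"
      using u[of i] by (cases "i \<in> Q") (auto simp: lf Q_def mult_nonpos_nonneg)
  qed
  finally show False by simp
qed

lemma law_of_inertia:
  fixes c :: "'j \<Rightarrow> real" and d :: "'i \<Rightarrow> real"
  assumes fin: "finite J" "finite I"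
    and dual: "\<And>j k. j \<in> J \<Longrightarrow> k \<in> J \<Longrightarrow> linear_form n (L j) (v k) = of_bool (j = k)"
      "\<And>j k. j \<in> I \<Longrightarrow> k \<in> I \<Longrightarrow> linear_form n (M j) (w k) = of_bool (j = k)"
    and eq: "\<And>x. (\<Sum>j\<in>J. c j * (cmod (linear_form n (L j) x))\<^sup>2)
                = (\<Sum>i\<in>I. d i * (cmod (linear_form n (M i) x))\<^sup>2)"
  shows "card {j \<in> J. c j > 0} = card {i \<in> I. d i > 0}"
    and "card {j \<in> J. c j < 0} = card {i \<in> I. d i < 0}"
proof -
  show "card {j \<in> J. c j > 0} = card {i \<in> I. d i > 0}"
    by (intro antisym inertia_le[OF fin dual(1) eq]
        inertia_le[OF fin(2,1) dual(2) eq[symmetric]])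
  have neg: "(\<Sum>j\<in>J. - c j * (cmod (linear_form n (L j) x))\<^sup>2)
      = (\<Sum>i\<in>I. - d i * (cmod (linear_form n (M i) x))\<^sup>2)" for x
    using eq[of x] by (simp add: sum_negf)
  have "card {j \<in> J. - c j > 0} = card {i \<in> I. - d i > 0}"
    by (intro antisym inertia_le[OF fin dual(1) neg]
        inertia_le[OF fin(2,1) dual(2) neg[symmetric]])
  then show "card {j \<in> J. c j < 0} = card {i \<in> I. d i < 0}" by simp
qed

section \<open>Roots of symmetric polynomials\<close>

lemma map_poly_cnj_mult: "map_poly cnj (p * q) = map_poly cnj p * map_poly cnj q"
  by (rule poly_ext) simp

lemma map_poly_cnj_power: "map_poly cnj (p ^ k) = map_poly cnj p ^ k"
  by (rule poly_ext) simp

text \<open>By symmetry the constant coefficient is the leading coefficient of the conjugate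
  polynomial, hence nonzero.\<close>

lemma symmetric_poly_root_nonzero:
  assumes "symmetric_poly g" "g \<noteq> 0" "poly g z = 0"
  shows "z \<noteq> 0"
proof
  assume "z = 0"
  have "poly g 0 = lead_coeff (map_poly cnj g)"
    using assms(1) by (metis symmetric_poly_def coeff_0_reflect_poly poly_0_coeff_0)
  moreover have "map_poly cnj g \<noteq> 0"
    using assms(1,2) by (metis symmetric_poly_def reflect_poly_0)
  ultimately show False using assms(3) \<open>z = 0\<close> by simp
qed

text \<open>Conjugation followed by reflection is multiplicative, fixes \<open>g\<close>, and sends
  the factor \<open>x - z\<close> to a nonzero constant times \<open>x - 1 / cnj z\<close>. Hence
  the power of the first factor dividing \<open>g\<close> becomes the same power of the
  second.\<close>

lemma symmetric_poly_order_le: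
  assumes "symmetric_poly g" "g \<noteq> 0" "z \<noteq> 0"
  shows "order z g \<le> order (1 / cnj z) g"
proof -
  define k where "k = order z g"
  obtain h where h: "g = [:- z, 1:] ^ k * h"
    using order_1[of z g] unfolding k_def by (elim dvdE)
  have "reflect_poly (map_poly cnj [:- z, 1:]) = smult (- cnj z) [:- (1 / cnj z), 1:]"
    using assms(3) by (simp add: map_poly_pCons reflect_poly_pCons)
  then have "g = (smult (- cnj z) [:- (1 / cnj z), 1:]) ^ k * reflect_poly (map_poly cnj h)"
    using assms(1) h unfolding symmetric_poly_def
    by (metis map_poly_cnj_mult map_poly_cnj_power reflect_poly_mult reflect_poly_power)
  then have "[:- (1 / cnj z), 1:] ^ k dvd g"
    by (metis smult_power dvd_triv_left mult_smult_left mult_smult_right)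
  then show ?thesis using assms(2) by (simp add: order_divides k_def)
qed

lemma symmetric_poly_order:
  assumes "symmetric_poly g" "g \<noteq> 0" "z \<noteq> 0"
  shows "order (1 / cnj z) g = order z g"
  using symmetric_poly_order_le[OF assms] symmetric_poly_order_le[OF assms(1,2), of "1 / cnj z"]
    assms(3) by simp

lemma symmetric_poly_root_iff:
  assumes "symmetric_poly g" "g \<noteq> 0" "z \<noteq> 0"
  shows "poly g (1 / cnj z) = 0 \<longleftrightarrow> poly g z = 0"
  using symmetric_poly_order[OF assms] assms(2) by (simp add: order_root)

lemma cmod_inverse_cnj: "cmod (1 / cnj z) = 1 / cmod z"
  by (simp add: norm_divide)

lemma inverse_cnj_eq_self_iff:
  assumes "z \<noteq> 0"
  shows "1 / cnj z = z \<longleftrightarrow> cmod z = 1"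
proof -
  have "1 / cnj z = z \<longleftrightarrow> z * cnj z = 1" using assms by (auto simp: field_simps)
  also have "\<dots> \<longleftrightarrow> (cmod z)\<^sup>2 = 1" by (metis complex_norm_square of_real_eq_1_iff)
  also have "\<dots> \<longleftrightarrow> cmod z = 1" by (simp add: power2_eq_1_iff) (smt (verit) norm_ge_zero)
  finally show ?thesis .
qed

section \<open>The form as a sum over the distinct roots\<close>

lemma sum_mset_eq_sum_count:
  fixes f :: "'a \<Rightarrow> 'b::comm_semiring_1"
  shows "(\<Sum>z\<in>#M. f z) = (\<Sum>z\<in>set_mset M. of_nat (count M z) * f z)"
proof (induction M)
  case (add a M)
  have "(\<Sum>z\<in>insert a (set_mset M). of_nat (count (add_mset a M) z) * f z)
      = (\<Sum>z\<in>insert a (set_mset M). of_nat (count M z) * f z + (if z = a then f z else 0))"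
    by (intro sum.cong) (auto simp: algebra_simps)
  also have "\<dots> = (\<Sum>z\<in>set_mset M. of_nat (count M z) * f z) + f a"
  proof -
    have "(\<Sum>z\<in>insert a (set_mset M). of_nat (count M z) * f z)
        = (\<Sum>z\<in>set_mset M. of_nat (count M z) * f z)"
      by (intro sum.mono_neutral_right) (auto simp: not_in_iff)
    then show ?thesis by (simp add: sum.distrib sum.delta)
  qed
  finally show ?case using add by (simp add: add.commute)
qed simp

text \<open>Here \<open>linear_form n (power z) x\<close> is the value at \<open>z\<close> of the
  polynomial with coefficients \<open>x\<close>. Writing the power sums over distinct roots, each
  root's double sum factors into two such values, because the negative exponent turns into a power
  of the reflected root.\<close>

lemma root_form_eq_sum_roots:
  assumes "g \<noteq> 0" "\<And>z. poly g z = 0 \<Longrightarrow> z \<noteq> 0"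
  shows "root_form g x = (\<Sum>z | poly g z = 0. of_nat (order z g) *
    (linear_form (degree g) (power z) x * cnj (linear_form (degree g) (power (1 / cnj z)) x)))"
proof -
  let ?n = "degree g" and ?R = "{z. poly g z = 0}"
  have ps: "root_power_sum g k = (\<Sum>z\<in>?R. of_nat (order z g) * z powi k)" for k
    using assms(1) by (simp add: root_power_sum_def sum_mset_eq_sum_count)
  have "root_form g x = (\<Sum>i<?n. \<Sum>k<?n. \<Sum>z\<in>?R.
      of_nat (order z g) * (z powi (int i - int k) * x i * cnj (x k)))"
    by (simp add: root_form_def ps sum_distrib_right mult.assoc)
  also have "\<dots> = (\<Sum>i<?n. \<Sum>z\<in>?R. \<Sum>k<?n.
      of_nat (order z g) * (z powi (int i - int k) * x i * cnj (x k)))"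
    by (intro sum.cong refl sum.swap)
  also have "\<dots> = (\<Sum>z\<in>?R. \<Sum>i<?n. \<Sum>k<?n.
      of_nat (order z g) * (z powi (int i - int k) * x i * cnj (x k)))"
    by (rule sum.swap)
  also have "\<dots> = (\<Sum>z\<in>?R. of_nat (order z g) *
    (linear_form ?n (power z) x * cnj (linear_form ?n (power (1 / cnj z)) x)))"
  proof (intro sum.cong refl)
    fix z assume "z \<in> ?R"
    then have "z \<noteq> 0" using assms by blast
    then have e: "z powi (int i - int k) * x i * cnj (x k)
        = (z ^ i * x i) * cnj ((1 / cnj z) ^ k * x k)" for i k
      by (simp add: power_int_diff power_one_over divide_simps)
    then show "(\<Sum>i<?n. \<Sum>k<?n. of_nat (order z g) * (z powi (int i - int k) * x i * cnj (x k)))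
      = of_nat (order z g) *
        (linear_form ?n (power z) x * cnj (linear_form ?n (power (1 / cnj z)) x))"
      unfolding linear_form_def cnj_sum sum_product e by (simp only: sum_distrib_left)
  qed
  finally show ?thesis .
qed

section \<open>Interpolation at the roots; symmetrized sums\<close>

lemma Lagrange_basis:
  fixes R :: "'a::field set"
  assumes "finite R" "z \<in> R"
  shows "\<exists>p. degree p < card R \<and> (\<forall>w\<in>R. poly p w = of_bool (w = z))"
proof -
  define q where "q = (\<Prod>w\<in>R - {z}. [:- w, 1:])"
  have q: "poly q x = (\<Prod>w\<in>R - {z}. x - w)" for x
    by (simp add: q_def poly_prod)
  have "degree q = card (R - {z})"
    by (simp add: q_def degree_prod_eq_sum_degree)
  moreover have "card R > 0" using assms card_gt_0_iff by blast
  ultimately have "degree q < card R" using assms by simp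
  moreover have "poly q z \<noteq> 0" using assms by (simp add: q)
  moreover have "poly q w = 0" if "w \<in> R" "w \<noteq> z" for w
    using assms that by (auto simp: q)
  ultimately show ?thesis
    by (intro exI[of _ "smult (1 / poly q z) q"]) auto
qed

lemma linear_form_power_coeff:
  assumes "degree p < n"
  shows "linear_form n (power z) (coeff p) = poly p z"
  using assms unfolding linear_form_def poly_altdef
  by (intro sum.mono_neutral_cong_right) (auto simp: coeff_eq_0)

text \<open>The coefficient vectors of the Lagrange polynomials are dual to evaluation at the roots.
  They fit into \<open>degree g\<close> variables since there are at most \<open>degree g\<close>
  distinct roots.\<close>

lemma evaluation_dual_vectors:
  fixes g :: "complex poly"
  assumes "g \<noteq> 0"
  shows "\<exists>e. \<forall>z w. poly g z = 0 \<longrightarrow> poly g w = 0 \<longrightarrow>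
    linear_form (degree g) (power w) (e z) = of_bool (w = z)"
proof -
  have "\<exists>y. poly g z = 0 \<longrightarrow> (\<forall>w. poly g w = 0 \<longrightarrow>
    linear_form (degree g) (power w) y = of_bool (w = z))" for z
  proof (cases "poly g z = 0")
    case True
    have fin: "finite {z. poly g z = 0}" using assms by (rule poly_roots_finite)
    obtain p where p: "degree p < card {z. poly g z = 0}"
      "\<forall>w. poly g w = 0 \<longrightarrow> poly p w = of_bool (w = z)"
      using Lagrange_basis[OF fin, of z] True by auto
    moreover have "card {z. poly g z = 0} \<le> degree g"
      using assms by (rule card_poly_roots_bound)
    ultimately show ?thesis
      by (intro exI[of _ "coeff p"]) (simp add: linear_form_power_coeff)
  qed simp
  then show ?thesis by metis
qed

text \<open>Summing \<open>H z + H (s z)\<close> over \<open>R\<close> counts every value of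
  \<open>H\<close> twice. This allows the terms of a root and its reflection to be compared jointly
  without choosing a representative of each pair.\<close>

lemma sum_eq_of_symmetrized_eq:
  fixes F G :: "'a \<Rightarrow> 'b::field_char_0"
  assumes bij: "bij_betw s R R"
    and eq: "\<And>z. z \<in> R \<Longrightarrow> F z + F (s z) = G z + G (s z)"
  shows "sum F R = sum G R"
proof -
  have dbl: "(\<Sum>z\<in>R. H z + H (s z)) = 2 * sum H R" for H :: "'a \<Rightarrow> 'b"
    using sum.reindex_bij_betw[OF bij, of H] by (simp add: sum.distrib)
  have "2 * sum F R = 2 * sum G R"
    using eq by (simp flip: dbl)
  then show ?thesis by simp
qed

section \<open>Counting roots by the signature\<close>

text \<open>The value is 1 inside the unit circle, 0 on it and -1 outside. This sign lets the roots
  themselves index all squares: in a pair, the inner root carries the sum and the outer root the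
  difference.\<close>

definition circle_sgn :: "complex \<Rightarrow> real" where
  "circle_sgn z = sgn (1 - cmod z)"

lemma circle_sgn_inverse_cnj:
  assumes "z \<noteq> 0"
  shows "circle_sgn (1 / cnj z) = - circle_sgn z"
  using assms by (auto simp: circle_sgn_def cmod_inverse_cnj sgn_if)

lemma circle_sgn_eq_0_iff: "circle_sgn z = 0 \<longleftrightarrow> cmod z = 1"
  by (auto simp: circle_sgn_def sgn_if)

text \<open>Off the circle the factor 1/2 comes from writing a pair's contribution as half the
  multiplicity times a difference of two squares.\<close>

definition root_coeff :: "complex poly \<Rightarrow> complex \<Rightarrow> real" where
  "root_coeff g z = (if cmod z = 1 then 1 else circle_sgn z / 2) * real (order z g)"

text \<open>With \<open>X(z)\<close> the evaluation at \<open>z\<close> and \<open>z'\<close> the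
  reflected root, this is \<open>X(z) + X(z')\<close> inside the circle, \<open>X(z) - X(z')\<close>
  outside and \<open>X(z)\<close> on it.\<close>

definition root_linear_form :: "complex \<Rightarrow> nat \<Rightarrow> complex" where
  "root_linear_form z = (\<lambda>t. z ^ t + of_real (circle_sgn z) * (1 / cnj z) ^ t)"

lemma linear_form_root_linear_form:
  "linear_form n (root_linear_form z) x
    = linear_form n (power z) x + of_real (circle_sgn z) * linear_form n (power (1 / cnj z)) x"
  unfolding root_linear_form_def by (rule linear_form_add_scaled_left)

lemma cmod_add_sq_minus_cmod_diff_sq:
  "of_real ((cmod (a + b))\<^sup>2) - of_real ((cmod (a - b))\<^sup>2) = 2 * (a * cnj b + b * cnj a)"
  unfolding complex_norm_square by (simp add: algebra_simps)

text \<open>The summands \<open>F z\<close> and \<open>G z\<close> need not agree off the circle;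
  only their totals over a root and its reflection do, so the two sums are compared after
  symmetrization.\<close>

lemma root_form_squares:
  assumes g: "symmetric_poly g" "g \<noteq> 0"
  shows "root_form g x = of_real
    (\<Sum>z | poly g z = 0. root_coeff g z * (cmod (linear_form (degree g) (root_linear_form z) x))\<^sup>2)"
proof -
  let ?R = "{z. poly g z = 0}"
  let ?X = "\<lambda>z. linear_form (degree g) (power z) x"
  define F where "F = (\<lambda>z. of_nat (order z g) * (?X z * cnj (?X (1 / cnj z))))"
  define G where "G = (\<lambda>z. complex_of_real (root_coeff g z *
    (cmod (linear_form (degree g) (root_linear_form z) x))\<^sup>2))"
  have nz: "z \<noteq> 0" if "poly g z = 0" for z
    using symmetric_poly_root_nonzero[OF g that] .
  have bij: "bij_betw (\<lambda>z. 1 / cnj z) ?R ?R"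
    by (rule bij_betw_byWitness[where f' = "\<lambda>z. 1 / cnj z"])
      (auto simp: symmetric_poly_root_iff[OF g] nz)
  \<comment> \<open>Off the circle it is enough to start from the inner root of a pair, since the
    claim is symmetric in \<open>z\<close> and \<open>1 / cnj z\<close>.\<close>
  have inside: "F z + F (1 / cnj z) = G z + G (1 / cnj z)" if "poly g z = 0" "cmod z < 1" for z
  proof -
    have s: "circle_sgn z = 1" using that(2) by (simp add: circle_sgn_def)
    have s': "circle_sgn (1 / cnj z) = - 1"
      using s circle_sgn_inverse_cnj[OF nz[OF that(1)]] by simp
    have c: "cmod (1 / cnj z) \<noteq> 1"
      using s' circle_sgn_eq_0_iff[of "1 / cnj z"] by auto
    let ?a = "?X z" and ?b = "?X (1 / cnj z)" and ?m = "of_nat (order z g) :: complex"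
    have m: "order (1 / cnj z) g = order z g"
      by (rule symmetric_poly_order[OF g nz[OF that(1)]])
    have "G z = ?m / 2 * of_real ((cmod (?a + ?b))\<^sup>2)"
      using that s unfolding G_def root_coeff_def linear_form_root_linear_form by simp
    \<comment> \<open>The form attached to the outer root takes the value \<open>?b - ?a\<close>,
      which has the same modulus as \<open>?a - ?b\<close>.\<close>
    moreover have "G (1 / cnj z) = - ?m / 2 * of_real ((cmod (?a - ?b))\<^sup>2)"
      using c unfolding G_def root_coeff_def linear_form_root_linear_form s' m
      by (simp add: norm_minus_commute)
    ultimately have "G z + G (1 / cnj z)
        = ?m / 2 * (of_real ((cmod (?a + ?b))\<^sup>2) - of_real ((cmod (?a - ?b))\<^sup>2))"
      by (simp only: algebra_simps) simp
    also have "\<dots> = ?m * (?a * cnj ?b + ?b * cnj ?a)"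
      unfolding cmod_add_sq_minus_cmod_diff_sq by simp
    also have "\<dots> = F z + F (1 / cnj z)"
      unfolding F_def m by (simp add: algebra_simps)
    finally show ?thesis by simp
  qed
  have "F z + F (1 / cnj z) = G z + G (1 / cnj z)" if "z \<in> ?R" for z
  proof -
    have z: "poly g z = 0" "z \<noteq> 0" using that nz by auto
    consider "cmod z < 1" | "cmod z = 1" | "cmod z > 1" by linarith
    then show ?thesis
    proof cases
      case 1
      then show ?thesis using inside z by blast
    next
      case 2
      then have e: "1 / cnj z = z" using z by (simp add: inverse_cnj_eq_self_iff)
      have "circle_sgn z = 0" using 2 by (simp add: circle_sgn_eq_0_iff)
      then have "G z = of_nat (order z g) * of_real ((cmod (?X z))\<^sup>2)"
        using 2 unfolding G_def root_coeff_def linear_form_root_linear_form by simp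
      also have "\<dots> = F z"
        unfolding F_def e complex_norm_square by simp
      finally show ?thesis unfolding e by simp
    next
      case 3
      let ?w = "1 / cnj z"
      have "cmod ?w < 1" "poly g ?w = 0" "1 / cnj ?w = z"
        using 3 z symmetric_poly_root_iff[OF g z(2)] by (simp_all add: cmod_inverse_cnj)
      then show ?thesis using inside[of ?w] by (simp only: add.commute)
    qed
  qed
  then have "sum F ?R = sum G ?R"
    by (rule sum_eq_of_symmetrized_eq[where s = "\<lambda>z. 1 / cnj z", OF bij])
  moreover have "root_form g x = sum F ?R"
    unfolding F_def by (rule root_form_eq_sum_roots[OF g(2) nz])
  ultimately show ?thesis by (simp add: G_def)
qed

text \<open>On a pair, with \<open>s\<close> the sign of \<open>z\<close>, the new forms arise from
  the two evaluations by the matrix with rows (1, s) and (-s, 1). Its rows are orthogonal of squared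
  length 1 + s^2, so the same combinations of the dual vectors \<open>e\<close>, divided by 1 + s^2,
  are dual to the new forms.\<close>

lemma root_linear_form_dual_vectors:
  assumes g: "symmetric_poly g" "g \<noteq> 0"
  shows "\<exists>v. \<forall>z\<in>{z. poly g z = 0}. \<forall>w\<in>{z. poly g z = 0}.
    linear_form (degree g) (root_linear_form w) (v z) = of_bool (w = z)"
proof -
  obtain e where e: "\<And>z w. poly g z = 0 \<Longrightarrow> poly g w = 0 \<Longrightarrow>
    linear_form (degree g) (power w) (e z) = of_bool (w = z)"
    using evaluation_dual_vectors[OF g(2)] by blast
  define s where "s = (\<lambda>z. complex_of_real (circle_sgn z))"
  define v where "v = (\<lambda>z t. 1 / (1 + (s z)\<^sup>2) * (e z t + s z * e (1 / cnj z) t))"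
  have "linear_form (degree g) (root_linear_form w) (v z) = of_bool (w = z)"
    if zw: "poly g z = 0" "poly g w = 0" for z w
  proof -
    let ?z = "1 / cnj z" and ?w = "1 / cnj w"
    have nz: "z \<noteq> 0" "w \<noteq> 0"
      using zw symmetric_poly_root_nonzero[OF g] by blast+
    have zw': "poly g ?z = 0" "poly g ?w = 0"
      using zw nz symmetric_poly_root_iff[OF g] by blast+
    have "linear_form (degree g) (root_linear_form w) (v z) = 1 / (1 + (s z)\<^sup>2) *
       (of_bool (w = z) + s z * of_bool (w = ?z) + s w * (of_bool (?w = z) + s z * of_bool (?w = ?z)))"
      unfolding v_def linear_form_scaled_right linear_form_add_scaled_right
        linear_form_root_linear_form
      by (simp add: e zw zw' s_def)
    also have "?w = ?z \<longleftrightarrow> w = z" by simp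
    also have "?w = z \<longleftrightarrow> w = ?z" by auto
    also have "1 / (1 + (s z)\<^sup>2) * (of_bool (w = z) + s z * of_bool (w = ?z)
        + s w * (of_bool (w = ?z) + s z * of_bool (w = z))) = of_bool (w = z)"
    proof -
      have "1 + (circle_sgn z)\<^sup>2 \<noteq> 0" by (smt (verit) zero_le_power2)
      then have d: "1 + (s z)\<^sup>2 \<noteq> 0"
        unfolding s_def by (metis of_real_1 of_real_add of_real_eq_0_iff of_real_power)
      \<comment> \<open>For reflected roots the opposite signs cancel the cross terms. A root equal
        to its own reflection has sign 0.\<close>
      have sw: "s w = - s z" if "w = ?z"
        using that circle_sgn_inverse_cnj[OF nz(1)] by (simp add: s_def)
      have s0: "s z = 0" if "w = z" "w = ?z"
        using that sw by simp
      show ?thesis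
        using d sw s0
        by (cases "w = z"; cases "w = ?z") (auto simp: power2_eq_square simp del: of_bool_eq_iff)
    qed
    finally show ?thesis .
  qed
  then show ?thesis by blast
qed

theorem theorem1:
  fixes g :: "complex poly" and p q :: nat
  assumes "symmetric_poly g"
    and "degree g \<ge> 1"
    and "squared_terms (degree g) (root_form g) p q"
  shows "int (card {z. poly g z = 0 \<and> cmod z = 1}) = int p - int q \<and>
    card {{\<beta>, 1 / cnj \<beta>} | \<beta>. poly g \<beta> = 0 \<and> poly g (1 / cnj \<beta>) = 0 \<and> cmod \<beta> \<noteq> 1} = q"
proof -
  have g: "symmetric_poly g" "g \<noteq> 0" using assms by auto
  define R where "R = {z. poly g z = 0}"
  define U where "U = {z \<in> R. cmod z = 1}"
  define A where "A = {z \<in> R. cmod z < 1}"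
  define B where "B = {z \<in> R. cmod z > 1}"
  have finR: "finite R" unfolding R_def using g(2) by (rule poly_roots_finite)
  have nz: "z \<noteq> 0" if "z \<in> R" for z
    using that symmetric_poly_root_nonzero[OF g] by (auto simp: R_def)
  have star: "1 / cnj z \<in> R" if "z \<in> R" for z
    using that nz[OF that] symmetric_poly_root_iff[OF g] by (auto simp: R_def)
  obtain v where v: "\<And>w z. w \<in> R \<Longrightarrow> z \<in> R \<Longrightarrow>
      linear_form (degree g) (root_linear_form w) (v z) = of_bool (w = z)"
    using root_linear_form_dual_vectors[OF g] unfolding R_def by blast
  obtain m c L where indep: "indep_linear_forms (degree g) m L"
    and H: "\<And>x. root_form g x = of_real (\<Sum>j<m. c j * (cmod (linear_form (degree g) (L j) x))\<^sup>2)"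
    and pq: "p = card {j. j < m \<and> c j > 0}" "q = card {j. j < m \<and> c j < 0}"
    using assms(3) unfolding squared_terms_def by blast
  obtain y where y: "\<And>j k. j \<in> {..<m} \<Longrightarrow> k \<in> {..<m} \<Longrightarrow>
      linear_form (degree g) (L j) (y k) = of_bool (j = k)"
    using indep_linear_forms_dual_vectors[OF indep] by auto
  have eq: "(\<Sum>j<m. c j * (cmod (linear_form (degree g) (L j) x))\<^sup>2)
      = (\<Sum>z\<in>R. root_coeff g z * (cmod (linear_form (degree g) (root_linear_form z) x))\<^sup>2)" for x
    using H[of x] root_form_squares[OF g, of x] unfolding R_def of_real_eq_iff[where 'a = complex, symmetric]
    by simp
  note inertia = law_of_inertia[OF finite_lessThan finR y v eq]
  have order_pos: "order z g > 0" if "z \<in> R" for z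
    using that g(2) by (simp add: R_def order_gt_0_iff)
  \<comment> \<open>All multiplicities are positive, so the sign of a coefficient depends only on
    the position of its root relative to the circle.\<close>
  have "{z \<in> R. root_coeff g z > 0} = U \<union> A"
    using order_pos
    by (auto simp: U_def A_def root_coeff_def circle_sgn_def sgn_if zero_less_mult_iff split: if_splits)
  moreover have "{z \<in> R. root_coeff g z < 0} = B"
    using order_pos
    by (auto simp: B_def root_coeff_def circle_sgn_def sgn_if mult_less_0_iff split: if_splits)
  moreover have "card (U \<union> A) = card U + card A"
    using finR by (intro card_Un_disjoint) (auto simp: U_def A_def)
  ultimately have p: "p = card U + card A" and q: "q = card B"
    using inertia pq by simp_all
  \<comment> \<open>Reflection exchanges the inside and the outside, so the inner roots cancel in
    \<open>p - q\<close> and only the roots on the circle remain.\<close>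
  have "bij_betw (\<lambda>z. 1 / cnj z) A B"
  proof (rule bij_betw_byWitness[where f' = "\<lambda>z. 1 / cnj z"])
    show "(\<lambda>z. 1 / cnj z) ` A \<subseteq> B"
      using star nz by (auto simp: A_def B_def cmod_inverse_cnj)
    show "(\<lambda>z. 1 / cnj z) ` B \<subseteq> A"
      using star nz by (auto simp: A_def B_def cmod_inverse_cnj)
  qed (auto simp: A_def B_def)
  then have AB: "card A = card B" by (rule bij_betw_same_card)
  \<comment> \<open>Each pair has exactly one member inside the circle, so the pairs are counted by
    \<open>A\<close>.\<close>
  have "{{\<beta>, 1 / cnj \<beta>} | \<beta>. poly g \<beta> = 0 \<and> poly g (1 / cnj \<beta>) = 0 \<and> cmod \<beta> \<noteq> 1}
      = (\<lambda>\<beta>. {\<beta>, 1 / cnj \<beta>}) ` A" (is "?P = ?f ` A")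
  proof (intro antisym subsetI)
    fix S assume "S \<in> ?P"
    then obtain \<beta> where S: "S = ?f \<beta>" and \<beta>: "\<beta> \<in> R" "1 / cnj \<beta> \<in> R" "cmod \<beta> \<noteq> 1"
      by (auto simp: R_def)
    show "S \<in> ?f ` A"
    proof (cases "cmod \<beta> < 1")
      case True
      then show ?thesis using S \<beta> by (auto simp: A_def)
    next
      case False
      with \<beta> have "cmod \<beta> > 1" by simp
      then have "1 / cnj \<beta> \<in> A" using \<beta> by (simp add: A_def cmod_inverse_cnj divide_less_eq)
      moreover have "S = ?f (1 / cnj \<beta>)" using S by auto
      ultimately show ?thesis by blast
    qed
  next
    fix S assume "S \<in> ?f ` A"
    then obtain \<beta> where "S = ?f \<beta>" "\<beta> \<in> A" by auto
    then show "S \<in> ?P" using star[of \<beta>] by (auto simp: A_def R_def)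
  qed
  moreover have "inj_on ?f A"
  proof (rule inj_onI)
    fix a b assume ab: "a \<in> A" "b \<in> A" "?f a = ?f b"
    have "cmod (1 / cnj b) > 1"
      using ab nz by (auto simp: A_def cmod_inverse_cnj)
    with ab have "a \<noteq> 1 / cnj b" by (auto simp: A_def)
    with ab(3) show "a = b" by (metis doubleton_eq_iff)
  qed
  ultimately have "card ?P = q" using AB q by (simp add: card_image)
  moreover have "{z. poly g z = 0 \<and> cmod z = 1} = U" by (auto simp: U_def R_def)
  ultimately show ?thesis using p q AB by simp
qed

end
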